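(* Let $1<p<\infty$, and let $r_1,r_2\ge 0$ and $s_1,s_2>0$ be real numbers. Let $T_0:\ell_p\to\ell_p$ be the bounded linear operator given, for $x=\{x_n\}_{n\ge1}$ (with $x_{-1}=x_0=0$), by $(T_0x)_n=s_1x_{n-2}+r_1x_n+s_1x_{n+2}$ if $n$ is odd and $(T_0x)_n=s_2x_{n-2}+r_2x_n+s_2x_{n+2}$ if $n$ is even. Then the point spectrum of $T_0$ over $\ell_p$ is $\sigma_p(T_0,\ell_p)=\emptyset$.
   Context: $\ell_p$ is the complex Banach space of $p$-summable sequences $x=\{x_n\}_{n\ge 1}$. The point spectrum $\sigma_p(A,X)$ of $A\in B(X)$ is the set of $\lambda\in\mathbb{C}$ for which $A-\lambda I$ is not injective. *)

theory Defs
  imports "HOL-Analysis.Analysis"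
begin

text \<open>
  A sequence $(x_n)_{n \ge 1}$ is a function on \<^typ>\<open>nat\<close> that vanishes at the index 0,
  which does not belong to the sequence. Vector operations are pointwise.
\<close>

definition lp :: "real \<Rightarrow> (nat \<Rightarrow> complex) set" where
  "lp p = {x. x 0 = 0 \<and> summable (\<lambda>n. norm (x n) powr p)}"

definition lp_norm :: "real \<Rightarrow> (nat \<Rightarrow> complex) \<Rightarrow> real" where
  "lp_norm p x = (\<Sum>n. norm (x n) powr p) powr (1 / p)"

definition lp_bounded_linear :: "real \<Rightarrow> ((nat \<Rightarrow> complex) \<Rightarrow> nat \<Rightarrow> complex) \<Rightarrow> bool" where
  "lp_bounded_linear p A \<longleftrightarrow>
     A \<in> lp p \<rightarrow> lp p \<and>
     (\<forall>x\<in>lp p. \<forall>y\<in>lp p. A (\<lambda>n. x n + y n) = (\<lambda>n. A x n + A y n)) \<and>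
     (\<forall>c. \<forall>x\<in>lp p. A (\<lambda>n. c * x n) = (\<lambda>n. c * A x n)) \<and>
     (\<exists>K. \<forall>x\<in>lp p. lp_norm p (A x) \<le> K * lp_norm p x)"

definition point_spectrum ::
  "((nat \<Rightarrow> complex) \<Rightarrow> nat \<Rightarrow> complex) \<Rightarrow> (nat \<Rightarrow> complex) set \<Rightarrow> complex set" where
  "point_spectrum A X = {c. \<not> inj_on (\<lambda>x n. A x n - c * x n) X}"

text \<open>
  For \<open>n = 1\<close> and \<open>n = 2\<close> the truncated difference \<open>n - 2\<close> is 0, and \<open>x 0 = 0\<close> on
  \<^const>\<open>lp\<close>; this is the convention $x_{-1} = x_0 = 0$.
\<close>

definition T0 ::
  "real \<Rightarrow> real \<Rightarrow> real \<Rightarrow> real \<Rightarrow> (nat \<Rightarrow> complex) \<Rightarrow> nat \<Rightarrow> complex" where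
  "T0 r1 r2 s1 s2 x n =
     (if n = 0 then 0
      else if odd n then of_real s1 * x (n - 2) + of_real r1 * x n + of_real s1 * x (n + 2)
      else of_real s2 * x (n - 2) + of_real r2 * x n + of_real s2 * x (n + 2))"

lemma norm_sum3_powr_le:
  fixes a b c :: complex
  assumes "0 < p" "0 \<le> M" "norm a \<le> M * u" "norm b \<le> M * v" "norm c \<le> M * w"
    "0 \<le> u" "0 \<le> v" "0 \<le> w"
  shows "norm (a + b + c) powr p \<le> (3 * M) powr p * (u powr p + v powr p + w powr p)"
proof -
  define m where "m = max u (max v w)"
  have m: "0 \<le> m" "u \<le> m" "v \<le> m" "w \<le> m" using assms by (auto simp: m_def)
  have "norm (a + b + c) \<le> norm a + norm b + norm c"
    by (metis add_mono_thms_linordered_semiring(3) norm_triangle_ineq order_trans)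
  also have "\<dots> \<le> M * m + M * m + M * m"
    using assms m by (intro add_mono) (meson mult_left_mono order_trans)+
  finally have "norm (a + b + c) powr p \<le> (3 * M * m) powr p"
    using assms by (intro powr_mono2) auto
  also have "\<dots> = (3 * M) powr p * m powr p"
    using assms m by (simp add: powr_mult)
  also have "m powr p \<le> u powr p + v powr p + w powr p"
    unfolding m_def max_def using powr_ge_zero[of u p] powr_ge_zero[of v p] powr_ge_zero[of w p]
    by auto
  finally show ?thesis by (simp add: mult_left_mono)
qed

lemma T0_lp_bounded_linear:
  assumes p: "1 < p"
  shows "lp_bounded_linear p (T0 r1 r2 s1 s2)"
proof -
  define M where "M = \<bar>r1\<bar> + \<bar>r2\<bar> + \<bar>s1\<bar> + \<bar>s2\<bar>"
  have M: "\<bar>r1\<bar> \<le> M" "\<bar>r2\<bar> \<le> M" "\<bar>s1\<bar> \<le> M" "\<bar>s2\<bar> \<le> M" by (auto simp: M_def)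
  then have M0: "0 \<le> M" by linarith
  define C where "C = (3 * M) powr p"
  have C0: "0 \<le> C" by (simp add: C_def)
  have main: "summable (\<lambda>n. norm (T0 r1 r2 s1 s2 x n) powr p) \<and>
     (\<Sum>n. norm (T0 r1 r2 s1 s2 x n) powr p) \<le> C * 3 * (\<Sum>n. norm (x n) powr p)"
    if x: "x \<in> lp p" for x
  proof -
    define f where "f n = norm (x n) powr p" for n
    define f' where "f' n = (if n = 0 then 0 else f (n - 2))" for n
    have f0: "f n \<ge> 0" for n by (simp add: f_def)
    have x0: "f 0 = 0" and sf: "summable f" using x p by (simp_all add: lp_def f_def[abs_def])
    have sf2: "summable (\<lambda>n. f (n + 2))" using sf by (subst summable_iff_shift)
    have "(\<lambda>n. f' (n + 2)) = f" by (auto simp: f'_def)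
    then have sf': "summable f'" using sf by (metis summable_iff_shift)
    have suf': "suminf f' = suminf f"
      using suminf_split_initial_segment[OF sf', of 2] \<open>(\<lambda>n. f' (n + 2)) = f\<close> x0
      by (simp add: f'_def numeral_2_eq_2)
    have suf2: "(\<Sum>n. f (n + 2)) \<le> suminf f"
      using suminf_split_initial_segment[OF sf, of 2] f0 by (simp add: sum_nonneg)
    define g where "g n = C * (f' n + f n + f (n + 2))" for n
    have sg: "summable g" unfolding g_def
      by (intro summable_mult summable_add sf sf' sf2)
    have le: "norm (T0 r1 r2 s1 s2 x n) powr p \<le> g n" for n
    proof (cases "n = 0")
      case True
      then show ?thesis using C0 f0 by (simp add: T0_def g_def f'_def)
    next
      case False
      then show ?thesis using M M0 p
        unfolding T0_def g_def C_def f_def f'_def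
        by (auto simp del: One_nat_def intro!: norm_sum3_powr_le mult_right_mono simp: norm_mult)
    qed
    have s: "summable (\<lambda>n. norm (T0 r1 r2 s1 s2 x n) powr p)"
      by (rule summable_comparison_test'[OF sg, of 0]) (use le in auto)
    have "(\<Sum>n. norm (T0 r1 r2 s1 s2 x n) powr p) \<le> suminf g"
      by (rule suminf_le[OF le s sg])
    also have "suminf g = C * (suminf f' + suminf f + (\<Sum>n. f (n + 2)))"
      unfolding g_def
      by (simp add: suminf_mult suminf_add summable_add sf sf' sf2 del: add_2_eq_Suc')
    also have "\<dots> \<le> C * (3 * suminf f)"
      using suf' suf2 C0 by (intro mult_left_mono) auto
    finally show ?thesis using s by (simp add: f_def[abs_def] mult.assoc)
  qed
  have "lp_norm p (T0 r1 r2 s1 s2 x) \<le> (C * 3) powr (1 / p) * lp_norm p x" if x: "x \<in> lp p" for x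
  proof -
    have "lp_norm p (T0 r1 r2 s1 s2 x) \<le> (C * 3 * (\<Sum>n. norm (x n) powr p)) powr (1 / p)"
      unfolding lp_norm_def using main[OF x] p
      by (intro powr_mono2) (auto intro: suminf_nonneg)
    also have "\<dots> = (C * 3) powr (1 / p) * lp_norm p x"
      unfolding lp_norm_def using C0 x by (auto simp: lp_def powr_mult suminf_nonneg)
    finally show ?thesis .
  qed
  moreover have "T0 r1 r2 s1 s2 \<in> lp p \<rightarrow> lp p"
    using main by (auto simp: lp_def T0_def)
  moreover have "T0 r1 r2 s1 s2 (\<lambda>n. x n + y n) = (\<lambda>n. T0 r1 r2 s1 s2 x n + T0 r1 r2 s1 s2 y n)"
    "T0 r1 r2 s1 s2 (\<lambda>n. c * x n) = (\<lambda>n. c * T0 r1 r2 s1 s2 x n)" for x y c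
    by (auto simp: T0_def fun_eq_iff algebra_simps)
  ultimately show ?thesis
    unfolding lp_bounded_linear_def by blast
qed

end

theory Submission
  imports Defs
begin

text \<open>
  On each parity class the eigenvalue equation becomes a recurrence
  \<open>u (k + 2) = m * u (k + 1) - u k\<close> with \<open>u 0 = 0\<close>. The quadratic form
  \<open>u (k + 1)\<^sup>2 - m * u k * u (k + 1) + u k\<^sup>2\<close> is constant along solutions, so it
  equals \<open>u 1\<^sup>2\<close>; for a null sequence it tends to 0, which forces \<open>u 1 = 0\<close> and \<open>u = 0\<close>.
\<close>

lemma null_sequence_recurrence_eq_0:
  fixes u :: "nat \<Rightarrow> 'a::real_normed_field"
  assumes u0: "u 0 = 0"
    and rec: "\<And>k. u (k + 2) = m * u (k + 1) - u k"
    and lim: "u \<longlonglongrightarrow> 0"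
  shows "u k = 0"
proof -
  define Q where "Q k = (u (Suc k))\<^sup>2 - m * u k * u (Suc k) + (u k)\<^sup>2" for k
  have rec': "u (Suc (Suc k)) = m * u (Suc k) - u k" for k
    using rec[of k] by simp
  have Q: "Q k = (u 1)\<^sup>2" for k
  proof (induction k)
    case (Suc k)
    \<comment> \<open>As \<open>u (k + 2)\<close> and \<open>u k\<close> add up to
      \<open>m * u (k + 1)\<close>, the polynomial \<open>t\<^sup>2 - m * u (k + 1) * t\<close>
      takes the same value at both.\<close>
    have "Q (Suc k) = Q k"
      by (simp add: Q_def rec' power2_eq_square algebra_simps)
    with Suc show ?case by simp
  qed (simp add: Q_def u0)
  have "Q \<longlonglongrightarrow> 0\<^sup>2 - m * 0 * 0 + 0\<^sup>2"
    unfolding Q_def by (intro tendsto_intros lim LIMSEQ_Suc)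
  moreover have "Q \<longlonglongrightarrow> (u 1)\<^sup>2"
    by (rule tendsto_eventually) (rule always_eventually, rule allI, rule Q)
  ultimately have "(u 1)\<^sup>2 = 0\<^sup>2 - m * 0 * 0 + 0\<^sup>2"
    by (rule LIMSEQ_unique[rotated])
  then have "u 1 = 0"
    by simp
  then have "u k = 0 \<and> u (Suc k) = 0"
    by (induction k) (simp_all add: u0 rec')
  then show ?thesis ..
qed

text \<open>The terms of a convergent series tend to 0, and taking the power \<open>1 / p\<close>
  undoes the exponent \<open>p\<close>.\<close>

lemma lp_LIMSEQ_0:
  assumes "0 < p" "x \<in> lp p"
  shows "x \<longlonglongrightarrow> 0"
proof -
  have "(\<lambda>n. norm (x n) powr p) \<longlonglongrightarrow> 0"
    using assms by (intro summable_LIMSEQ_zero) (simp add: lp_def)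
  then have "(\<lambda>n. (norm (x n) powr p) powr (1 / p)) \<longlonglongrightarrow> 0"
    by (rule tendsto_zero_powrI[OF _ tendsto_const]) (use assms in auto)
  then show ?thesis
    using assms by (simp add: powr_powr tendsto_norm_zero_iff)
qed

theorem theorem3p2:
  fixes p r1 r2 s1 s2 :: real
  assumes "1 < p" and "0 \<le> r1" and "0 \<le> r2" and "0 < s1" and "0 < s2"
  shows "point_spectrum (T0 r1 r2 s1 s2) (lp p) = {}"
proof -
  have "x = y"
    if x: "x \<in> lp p" and y: "y \<in> lp p"
      and eq: "(\<lambda>n. T0 r1 r2 s1 s2 x n - c * x n) = (\<lambda>n. T0 r1 r2 s1 s2 y n - c * y n)"
    for c x y
  proof -
    \<comment> \<open>By linearity, two points with the same image under \<open>T0 - c\<close>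
      differ by a solution of the eigenvalue equation.\<close>
    define z where "z n = x n - y n" for n
    have z0: "z 0 = 0"
      using x y by (simp add: z_def lp_def)
    have lim: "z \<longlonglongrightarrow> 0"
      unfolding z_def using tendsto_diff[OF lp_LIMSEQ_0[OF _ x] lp_LIMSEQ_0[OF _ y]] assms by simp
    have T0z: "T0 r1 r2 s1 s2 z n = c * z n" for n
      using fun_cong[OF eq, of n] by (auto simp: T0_def z_def algebra_simps split: if_splits)
    \<comment> \<open>Truncated subtraction sends \<open>k = 0\<close> to index 0, so
      \<open>z 0 = 0\<close> plays the boundary value at index -1; \<open>k \<ge> 1\<close> runs
      through the odd indices.\<close>
    have odd: "z (2 * k - 1) = 0" for k
    proof (rule null_sequence_recurrence_eq_0[where u = "\<lambda>k. z (2 * k - 1)"])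
      \<comment> \<open>This is the eigenvalue equation at \<open>2 * k + 1\<close>, solved for its
        last term and divided by \<open>s1 > 0\<close>.\<close>
      show "z (2 * (k + 2) - 1) = (c - r1) / s1 * z (2 * (k + 1) - 1) - z (2 * k - 1)" for k
      proof -
        have "of_real s1 * z (2 * k - 1) + of_real r1 * z (2 * k + 1) + of_real s1 * z (2 * k + 3)
          = c * z (2 * k + 1)"
          using T0z[of "2 * k + 1"] by (simp add: T0_def numeral_3_eq_3)
        moreover have "2 * (k + 2) - 1 = 2 * k + 3" "2 * (k + 1) - 1 = 2 * k + 1"
          by simp_all
        ultimately show ?thesis
          using assms by (simp add: field_simps numeral_3_eq_3)
      qed
      \<comment> \<open>The indices tend to infinity because \<open>k \<le> 2 * k - 1\<close>, even
        at \<open>k = 0\<close> by truncation.\<close>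
      show "(\<lambda>k. z (2 * k - 1)) \<longlonglongrightarrow> 0"
        by (rule filterlim_compose[OF lim], rule filterlim_at_top_mono[OF filterlim_ident])
           (rule always_eventually, presburger)
    qed (simp add: z0)
    have even: "z (2 * k) = 0" for k
    proof (rule null_sequence_recurrence_eq_0[where u = "\<lambda>k. z (2 * k)"])
      show "z (2 * (k + 2)) = (c - r2) / s2 * z (2 * (k + 1)) - z (2 * k)" for k
        using T0z[of "2 * k + 2"] assms
        by (simp add: T0_def field_simps)
      show "(\<lambda>k. z (2 * k)) \<longlonglongrightarrow> 0"
        by (rule filterlim_compose[OF lim], rule filterlim_at_top_mono[OF filterlim_ident])
           (rule always_eventually, presburger)
    qed (simp add: z0)
    have "z n = 0" for n
    proof (cases "even n")
      case True
      then show ?thesis using even by (auto elim: evenE)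
    next
      case False
      then obtain k where "n = 2 * (k + 1) - 1" by (auto elim: oddE)
      then show ?thesis using odd by blast
    qed
    then show ?thesis by (auto simp: z_def)
  qed
  then show ?thesis
    by (auto simp: point_spectrum_def inj_on_def)
qed

end
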